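(* Let $k\ge 1$ be an integer and $0<p<1$. The geometric distribution of order $k$ with parameter $p$ has the unique mode $m=k$.
   Context: For an integer $k\ge 1$ and $0<p<1$, $q=1-p$, the geometric distribution of order $k$ with parameter $p$ is the distribution on the integers with probability mass function $$P_n=p^n\sum \binom{n_1+n_2+\cdots+n_k}{n_1,\,n_2,\ldots,n_k}\left(\frac{q}{p}\right)^{n_1+n_2+\cdots+n_k}\quad (n\ge k),$$ and $P_n=0$ for $n<k$, where the sum is over all $k$-tuples of non-negative integers $(n_1,\ldots,n_k)$ with $n_1+2n_2+\cdots+kn_k=n-k$, and $\binom{N}{a_1,\ldots,a_{k}}=\frac{N!}{a_1!\cdots a_{k}!}$ denotes the multinomial coefficient. (It is the case $r=1$ of the negative binomial distribution of order $k$, type I, with parameters $r$ and $p$.) A mode is an integer $n$ at which $P_n$ attains its maximum. *)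

theory Defs
  imports Complex_Main "HOL-Library.FuncSet"
begin

definition multinomial :: "'i set \<Rightarrow> ('i \<Rightarrow> nat) \<Rightarrow> real" where
  "multinomial I a = fact (\<Sum>i\<in>I. a i) / (\<Prod>i\<in>I. fact (a i))"

text \<open>
  A \<open>k\<close>-tuple \<open>(n\<^sub>1, \<dots>, n\<^sub>k)\<close> is a function that is \<^const>\<open>undefined\<close> outside \<open>{1..k}\<close>,
  so that every tuple is counted exactly once.
\<close>

definition weighted_tuples :: "nat \<Rightarrow> int \<Rightarrow> (nat \<Rightarrow> nat) set" where
  "weighted_tuples k s = {a \<in> {1..k} \<rightarrow>\<^sub>E UNIV. int (\<Sum>i=1..k. i * a i) = s}"

lemma finite_weighted_tuples: "finite (weighted_tuples k s)"
proof (rule finite_subset)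
  show "weighted_tuples k s \<subseteq> {1..k} \<rightarrow>\<^sub>E {..nat s}"
  proof
    fix a assume a: "a \<in> weighted_tuples k s"
    have "a i \<le> nat s" if i: "i \<in> {1..k}" for i
    proof -
      have "a i \<le> i * a i" using i by simp
      also have "\<dots> \<le> (\<Sum>i=1..k. i * a i)"
        using i by (intro member_le_sum) auto
      also have "\<dots> = nat s"
        using a unfolding weighted_tuples_def by (metis (mono_tags, lifting) mem_Collect_eq nat_int)
      finally show ?thesis .
    qed
    with a show "a \<in> {1..k} \<rightarrow>\<^sub>E {..nat s}"
      by (auto simp: weighted_tuples_def PiE_iff)
  qed
  show "finite ({1..k} \<rightarrow>\<^sub>E {..nat s})"
    by (intro finite_PiE) auto
qed

definition geometric_order :: "nat \<Rightarrow> real \<Rightarrow> int \<Rightarrow> real" where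
  "geometric_order k p n =
     (if n < int k then 0
      else p powi n * (\<Sum>a\<in>weighted_tuples k (n - int k).
             multinomial {1..k} a * ((1 - p) / p) ^ (\<Sum>i=1..k. a i)))"

definition is_mode :: "(int \<Rightarrow> real) \<Rightarrow> int \<Rightarrow> bool" where
  "is_mode P n \<longleftrightarrow> (\<forall>m. P m \<le> P n)"

end

theory Submission
  imports Defs
begin

text \<open>
  Pascal's rule for multinomial coefficients gives the recurrence
  \<open>P\<^sub>n = \<Sum>\<^sub>j q p\<^bsup>j-1\<^esup> P\<^bsub>n-j\<^esub>\<close> for \<open>n > k\<close>, where \<open>j\<close> ranges over \<open>1, \<dots>, k\<close>. Its coefficients sum
  to \<open>1 - p\<^sup>k < 1\<close>, so by strong induction \<open>P\<^sub>n \<le> (1 - p\<^sup>k) P\<^sub>k < P\<^sub>k\<close> for all \<open>n > k\<close>.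
\<close>

text \<open>The weight \<open>c\<close> is kept general: the constant 1 gives the size of a tuple,
  and \<open>c i = i\<close> gives its weighted sum.\<close>

lemma sum_fun_upd_Suc:
  fixes c b :: "'i \<Rightarrow> nat"
  assumes "finite I" "j \<in> I"
  shows "(\<Sum>i\<in>I. c i * (b(j := Suc (b j))) i) = c j + (\<Sum>i\<in>I. c i * b i)"
  using assms by (simp add: sum.remove)

text \<open>Raising entry \<open>j\<close> multiplies the numerator factorial by the new total and
  the denominator by the new entry.\<close>

lemma multinomial_fun_upd_Suc:
  assumes "finite I" "j \<in> I"
  shows "real (Suc (b j)) * multinomial I (b(j := Suc (b j))) =
         real (Suc (\<Sum>i\<in>I. b i)) * multinomial I b"
proof -
  have "(\<Prod>i\<in>I. fact ((b(j := Suc (b j))) i) :: real) = real (Suc (b j)) * (\<Prod>i\<in>I. fact (b i))"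
    using assms by (simp add: prod.remove algebra_simps)
  moreover have "(\<Sum>i\<in>I. (b(j := Suc (b j))) i) = Suc (\<Sum>i\<in>I. b i)"
    using sum_fun_upd_Suc[OF assms, of "\<lambda>_. 1" b] by simp
  ultimately show ?thesis
    unfolding multinomial_def by (simp add: field_simps del: fun_upd_apply of_nat_Suc)
qed

text \<open>This is the coefficient of t^s in 1 / (1 - x (t + ... + t^k)). Integer indices make it 0
  for negative \<open>s\<close>, so the recurrence needs no boundary cases.\<close>

definition tuple_sum :: "nat \<Rightarrow> real \<Rightarrow> int \<Rightarrow> real" where
  "tuple_sum k x s =
     (\<Sum>a\<in>weighted_tuples k s. multinomial {1..k} a * x ^ (\<Sum>i=1..k. a i))"

lemma weighted_tuples_neg:
  assumes "s < 0"
  shows "weighted_tuples k s = {}"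
  using assms unfolding weighted_tuples_def by (auto simp del: of_nat_sum)

lemma weighted_tuples_0: "weighted_tuples k 0 = {\<lambda>i\<in>{1..k}. 0}"
  by (auto simp: weighted_tuples_def PiE_iff fun_eq_iff extensional_def simp del: of_nat_sum)

lemma tuple_sum_neg: "s < 0 \<Longrightarrow> tuple_sum k x s = 0"
  by (simp add: tuple_sum_def weighted_tuples_neg)

lemma tuple_sum_0: "tuple_sum k x 0 = 1"
  by (simp add: tuple_sum_def weighted_tuples_0 multinomial_def)

lemma bij_betw_weighted_tuples_incr:
  assumes "j \<in> {1..k}"
  shows "bij_betw (\<lambda>b. b(j := Suc (b j))) (weighted_tuples k (s - int j))
           {a \<in> weighted_tuples k s. 0 < a j}"
proof (rule bij_betw_byWitness[where f' = "\<lambda>a. a(j := a j - 1)"])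
  have incr: "(\<Sum>i=1..k. i * (b(j := Suc (b j))) i) = j + (\<Sum>i=1..k. i * b i)" for b
    using sum_fun_upd_Suc[OF _ assms, of "\<lambda>i. i" b] by simp
  show "(\<lambda>b. b(j := Suc (b j))) ` weighted_tuples k (s - int j)
          \<subseteq> {a \<in> weighted_tuples k s. 0 < a j}"
  proof
    fix a assume "a \<in> (\<lambda>b. b(j := Suc (b j))) ` weighted_tuples k (s - int j)"
    then obtain b where b: "b \<in> weighted_tuples k (s - int j)" and a: "a = b(j := Suc (b j))"
      by auto
    have "int (\<Sum>i=1..k. i * a i) = s"
      using b unfolding a incr weighted_tuples_def by (simp del: of_nat_sum)
    moreover have "a \<in> {1..k} \<rightarrow>\<^sub>E UNIV"
      using b assms unfolding a weighted_tuples_def by (auto simp: PiE_iff extensional_def)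
    ultimately show "a \<in> {a \<in> weighted_tuples k s. 0 < a j}"
      using a by (simp add: weighted_tuples_def)
  qed
  show "(\<lambda>a. a(j := a j - 1)) ` {a \<in> weighted_tuples k s. 0 < a j}
          \<subseteq> weighted_tuples k (s - int j)"
  proof
    fix b assume "b \<in> (\<lambda>a. a(j := a j - 1)) ` {a \<in> weighted_tuples k s. 0 < a j}"
    then obtain a where a: "a \<in> weighted_tuples k s" "0 < a j" and b: "b = a(j := a j - 1)"
      by auto
    have "a = b(j := Suc (b j))"
      using a b by auto
    then have "int (\<Sum>i=1..k. i * b i) = s - int j"
      using a(1) incr[of b] unfolding weighted_tuples_def by (simp del: of_nat_sum)
    moreover have "b \<in> {1..k} \<rightarrow>\<^sub>E UNIV"
      using a assms unfolding b weighted_tuples_def by (auto simp: PiE_iff extensional_def)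
    ultimately show "b \<in> weighted_tuples k (s - int j)"
      by (simp add: weighted_tuples_def)
  qed
qed auto

text \<open>Each term is split into shares \<open>a j / N a\<close>, which add up to 1 because
  \<open>s \<noteq> 0\<close> excludes the zero tuple. Collecting the shares by \<open>j\<close>
  gives the summands on the right.\<close>

lemma tuple_sum_rec:
  assumes "s \<noteq> 0"
  shows "tuple_sum k x s = (\<Sum>j=1..k. x * tuple_sum k x (s - int j))"
proof -
  define N where "N a = (\<Sum>i=1..k. a i)" for a :: "nat \<Rightarrow> nat"
  define w where "w a = multinomial {1..k} a * x ^ N a" for a
  define W where "W = weighted_tuples k s"
  have split: "w a = (\<Sum>j=1..k. real (a j) / real (N a) * w a)" if "a \<in> W" for a
  proof -
    have "N a \<noteq> 0"
    proof
      assume "N a = 0"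
      then have "(\<Sum>i=1..k. i * a i) = 0"
        by (simp add: N_def)
      with that assms show False
        by (simp add: W_def weighted_tuples_def del: of_nat_sum)
    qed
    moreover have "(\<Sum>j=1..k. real (a j) / real (N a) * w a) = real (N a) / real (N a) * w a"
      unfolding sum_distrib_right[symmetric] sum_divide_distrib[symmetric] by (simp add: N_def)
    ultimately show ?thesis by simp
  qed
  \<comment> \<open>Tuples with \<open>a j = 0\<close> have share 0; the others arise by raising
    entry \<open>j\<close> of a tuple of weight \<open>s - j\<close>, and the share then cancels the
    factor by which the multinomial grows.\<close>
  have part: "(\<Sum>a\<in>W. real (a j) / real (N a) * w a) = x * tuple_sum k x (s - int j)"
    if j: "j \<in> {1..k}" for j
  proof -
    have N_Suc: "N (b(j := Suc (b j))) = Suc (N b)" for b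
      using sum_fun_upd_Suc[OF _ j, of "\<lambda>_. 1" b] by (simp add: N_def)
    have step: "real (Suc (b j)) / real (Suc (N b)) * w (b(j := Suc (b j))) = x * w b" for b
    proof -
      have "real (Suc (b j)) * multinomial {1..k} (b(j := Suc (b j))) =
            real (Suc (N b)) * multinomial {1..k} b"
        unfolding N_def by (rule multinomial_fun_upd_Suc) (use j in auto)
      then show ?thesis
        unfolding w_def N_Suc by (simp add: field_simps del: of_nat_Suc)
    qed
    have "(\<Sum>a\<in>W. real (a j) / real (N a) * w a) =
          (\<Sum>a\<in>{a \<in> W. 0 < a j}. real (a j) / real (N a) * w a)"
      by (rule sum.mono_neutral_right) (auto simp: W_def finite_weighted_tuples)
    also have "\<dots> = (\<Sum>b\<in>weighted_tuples k (s - int j).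
        real (Suc (b j)) / real (Suc (N b)) * w (b(j := Suc (b j))))"
      unfolding W_def
      by (subst sum.reindex_bij_betw[OF bij_betw_weighted_tuples_incr[OF j], symmetric])
         (simp add: N_Suc)
    also have "\<dots> = x * tuple_sum k x (s - int j)"
      unfolding step by (simp add: tuple_sum_def w_def N_def sum_distrib_left)
    finally show ?thesis .
  qed
  have "tuple_sum k x s = (\<Sum>a\<in>W. w a)"
    by (simp add: tuple_sum_def w_def N_def W_def)
  also have "\<dots> = (\<Sum>a\<in>W. \<Sum>j=1..k. real (a j) / real (N a) * w a)"
    by (rule sum.cong[OF refl split])
  also have "\<dots> = (\<Sum>j=1..k. \<Sum>a\<in>W. real (a j) / real (N a) * w a)"
    by (rule sum.swap)
  also have "\<dots> = (\<Sum>j=1..k. x * tuple_sum k x (s - int j))"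
    by (rule sum.cong[OF refl part])
  finally show ?thesis .
qed

text \<open>The sum telescopes: its \<open>j\<close>-th term is p^(j-1) - p^j.\<close>

lemma sum_geometric_weights:
  fixes p :: real
  assumes "p \<noteq> 0"
  shows "(\<Sum>j=1..k. (1 - p) / p * p ^ j) = 1 - p ^ k"
proof (induction k)
  case (Suc k)
  have "(\<Sum>j=1..Suc k. (1 - p) / p * p ^ j) = (1 - p ^ k) + (1 - p) / p * p ^ Suc k"
    using Suc by simp
  also have "\<dots> = 1 - p ^ Suc k"
    using assms by (simp add: field_simps)
  finally show ?case .
qed simp

text \<open>Multiplied by \<open>p powi s\<close>, the recurrence has nonnegative weights of total
  \<open>1 - p ^ k\<close>. This serves both the induction for the bound 1 and, afterwards, the
  strict bound.\<close>

lemma tuple_sum_step: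
  fixes p :: real
  assumes p: "0 < p" "p < 1" and "s \<noteq> 0"
    and le: "\<And>j. j \<in> {1..k} \<Longrightarrow> p powi (s - int j) * tuple_sum k ((1 - p) / p) (s - int j) \<le> 1"
  shows "p powi s * tuple_sum k ((1 - p) / p) s \<le> 1 - p ^ k"
proof -
  let ?x = "(1 - p) / p"
  let ?f = "\<lambda>s. p powi s * tuple_sum k ?x s"
  have "?f s = (\<Sum>j=1..k. ?x * p ^ j * ?f (s - int j))"
    unfolding tuple_sum_rec[OF \<open>s \<noteq> 0\<close>, of k ?x] sum_distrib_left
    using p by (intro sum.cong refl) (simp add: power_int_diff)
  also have "\<dots> \<le> (\<Sum>j=1..k. ?x * p ^ j)"
    using p le by (intro sum_mono mult_left_le) auto
  also have "\<dots> = 1 - p ^ k"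
    using p by (intro sum_geometric_weights) auto
  finally show ?thesis .
qed

lemma tuple_sum_le:
  fixes p :: real
  assumes p: "0 < p" "p < 1"
  shows "p powi s * tuple_sum k ((1 - p) / p) s \<le> 1"
\<comment> \<open>For \<open>s > 0\<close> and \<open>j \<ge> 1\<close>,
  \<open>nat (s - int j)\<close> is below \<open>nat s\<close> even if \<open>s - int j\<close> is
  negative, so the hypothesis covers every predecessor.\<close>
proof (induction "nat s" arbitrary: s rule: less_induct)
  case less
  consider "s < 0" | "s = 0" | "s > 0" by linarith
  then show ?case
  proof cases
    case 3
    have "p powi s * tuple_sum k ((1 - p) / p) s \<le> 1 - p ^ k"
      using p 3 by (intro tuple_sum_step less) auto
    then show ?thesis
      using p by (smt (verit) zero_le_power)
  qed (simp_all add: tuple_sum_neg tuple_sum_0)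
qed

text \<open>Factoring out \<open>p ^ k\<close>, the value at the mode, turns the claim into a
  comparison with 1.\<close>

lemma geometric_order_eq:
  assumes "p \<noteq> 0"
  shows "geometric_order k p n =
         p ^ k * (p powi (n - int k) * tuple_sum k ((1 - p) / p) (n - int k))"
proof (cases "n < int k")
  case True
  then show ?thesis
    by (simp add: geometric_order_def tuple_sum_neg)
next
  case False
  then show ?thesis
    using assms by (simp add: geometric_order_def tuple_sum_def power_int_diff)
qed

theorem corollary2p1:
  fixes k :: nat and p :: real
  assumes "k \<ge> 1" and "0 < p" and "p < 1"
  shows "\<forall>m::int. is_mode (geometric_order k p) m \<longleftrightarrow> m = int k"
proof -
  have mode: "geometric_order k p (int k) = p ^ k"
    using assms by (simp add: geometric_order_eq tuple_sum_0)
  have less: "geometric_order k p n < p ^ k" if "n \<noteq> int k" for n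
  proof -
    \<comment> \<open>Only \<open>n - int k \<noteq> 0\<close> is required, so indices below
      \<open>k\<close> are treated together with those above.\<close>
    have "p powi (n - int k) * tuple_sum k ((1 - p) / p) (n - int k) \<le> 1 - p ^ k"
      using assms that by (intro tuple_sum_step tuple_sum_le) auto
    also have "\<dots> < 1"
      using assms by simp
    finally show ?thesis
      using assms by (simp add: geometric_order_eq)
  qed
  show ?thesis
    unfolding is_mode_def using mode less by (metis less_imp_le linorder_not_le order_refl)
qed

end
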